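(* Let $(G,f)$ be a ternary group (an $n$-ary group with $n=3$) and let $e\in G$. Then a representation $\Gamma: Ret_e(G,f)\rightarrow GL(V)$ is also a representation of $(G,f)$ if and only if $$\Gamma(\overline{x})=\Gamma(x)^{-1}$$ for every $x\in G$.
   Context: A ternary group is a non-empty set $G$ with an operation $f:G^3\to G$ that is associative, i.e. $f(f(x_1,x_2,x_3),x_4,x_5)=f(x_1,f(x_2,x_3,x_4),x_5)=f(x_1,x_2,f(x_3,x_4,x_5))$, and such that each of the equations $f(z,x_2,x_3)=x_0$, $f(x_1,z,x_3)=x_0$, $f(x_1,x_2,z)=x_0$ has a unique solution $z\in G$ for all given elements. The skew element $\overline{x}$ of $x$ is the unique $z$ with $f(x,x,z)=x$. The retract $Ret_e(G,f)$ is the set $G$ with binary operation $x\ast y=f(x,e,y)$; it is a group with identity $\overline{e}$. All vector spaces are finite dimensional over $\mathbb{C}$. A representation of the group $Ret_e(G,f)$ is an ordinary group representation. A representation of the ternary group $(G,f)$ is a map $\Lambda:G\to GL(V)$ with $\Lambda(f(x,y,z))=\Lambda(x)\Lambda(y)\Lambda(z)$ for all $x,y,z\in G$ such that $\ker\Lambda=\{x\in G:\Lambda(x)=\mathrm{id}\}$ is non-empty. *)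

theory Defs
  imports Complex_Main "HOL-Algebra.Group"
begin

locale ternary_group =
  fixes G :: "'a set" and f :: "'a \<Rightarrow> 'a \<Rightarrow> 'a \<Rightarrow> 'a"
  assumes nonempty: "G \<noteq> {}"
    and closed: "\<lbrakk>x \<in> G; y \<in> G; z \<in> G\<rbrakk> \<Longrightarrow> f x y z \<in> G"
    and assoc1: "\<lbrakk>x1 \<in> G; x2 \<in> G; x3 \<in> G; x4 \<in> G; x5 \<in> G\<rbrakk>
      \<Longrightarrow> f (f x1 x2 x3) x4 x5 = f x1 (f x2 x3 x4) x5"
    and assoc2: "\<lbrakk>x1 \<in> G; x2 \<in> G; x3 \<in> G; x4 \<in> G; x5 \<in> G\<rbrakk>
      \<Longrightarrow> f x1 (f x2 x3 x4) x5 = f x1 x2 (f x3 x4 x5)"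
    and solve1: "\<lbrakk>x2 \<in> G; x3 \<in> G; x0 \<in> G\<rbrakk> \<Longrightarrow> \<exists>!z. z \<in> G \<and> f z x2 x3 = x0"
    and solve2: "\<lbrakk>x1 \<in> G; x3 \<in> G; x0 \<in> G\<rbrakk> \<Longrightarrow> \<exists>!z. z \<in> G \<and> f x1 z x3 = x0"
    and solve3: "\<lbrakk>x1 \<in> G; x2 \<in> G; x0 \<in> G\<rbrakk> \<Longrightarrow> \<exists>!z. z \<in> G \<and> f x1 x2 z = x0"

definition skew :: "'a set \<Rightarrow> ('a \<Rightarrow> 'a \<Rightarrow> 'a \<Rightarrow> 'a) \<Rightarrow> 'a \<Rightarrow> 'a" where
  "skew G f x = (THE z. z \<in> G \<and> f x x z = x)"

definition retract :: "'a set \<Rightarrow> ('a \<Rightarrow> 'a \<Rightarrow> 'a \<Rightarrow> 'a) \<Rightarrow> 'a \<Rightarrow> 'a monoid" where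
  "retract G f e = \<lparr>carrier = G, mult = (\<lambda>x y. f x e y), one = skew G f e\<rparr>"

text \<open>The vector space is the whole type \<open>'v\<close> with scalar multiplication \<open>scale\<close>.\<close>

definition GL :: "(complex \<Rightarrow> 'v \<Rightarrow> 'v::ab_group_add) \<Rightarrow> ('v \<Rightarrow> 'v) monoid" where
  "GL scale = \<lparr>carrier = {T. Vector_Spaces.linear scale scale T \<and> bij T},
               mult = (\<circ>), one = id\<rparr>"

definition group_rep ::
  "'a monoid \<Rightarrow> (complex \<Rightarrow> 'v \<Rightarrow> 'v::ab_group_add) \<Rightarrow> ('a \<Rightarrow> 'v \<Rightarrow> 'v) \<Rightarrow> bool" where
  "group_rep H scale \<Gamma> \<longleftrightarrow> \<Gamma> \<in> hom H (GL scale)"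

definition ternary_ker ::
  "'a set \<Rightarrow> (complex \<Rightarrow> 'v \<Rightarrow> 'v::ab_group_add) \<Rightarrow> ('a \<Rightarrow> 'v \<Rightarrow> 'v) \<Rightarrow> 'a set" where
  "ternary_ker G scale \<Lambda> = {x \<in> G. \<Lambda> x = \<one>\<^bsub>GL scale\<^esub>}"

definition ternary_rep ::
  "'a set \<Rightarrow> ('a \<Rightarrow> 'a \<Rightarrow> 'a \<Rightarrow> 'a) \<Rightarrow> (complex \<Rightarrow> 'v \<Rightarrow> 'v::ab_group_add) \<Rightarrow>
    ('a \<Rightarrow> 'v \<Rightarrow> 'v) \<Rightarrow> bool" where
  "ternary_rep G f scale \<Lambda> \<longleftrightarrow>
     \<Lambda> \<in> G \<rightarrow> carrier (GL scale) \<and>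
     (\<forall>x\<in>G. \<forall>y\<in>G. \<forall>z\<in>G.
        \<Lambda> (f x y z) = \<Lambda> x \<otimes>\<^bsub>GL scale\<^esub> \<Lambda> y \<otimes>\<^bsub>GL scale\<^esub> \<Lambda> z) \<and>
     ternary_ker G scale \<Lambda> \<noteq> {}"

context ternary_group
begin

lemma skew_props:
  assumes x: "x \<in> G"
  shows "skew G f x \<in> G" "f x x (skew G f x) = x"
  using theI'[OF solve3[OF x x x]] by (simp_all add: skew_def)

lemma skew_right_neutral:
  assumes x: "x \<in> G" and y: "y \<in> G"
  shows "f y x (skew G f x) = y"
proof -
  note s = skew_props[OF x]
  obtain u where u: "u \<in> G" "f u x x = y" using solve1[OF x x y] by blast
  have "f (f u x x) x (skew G f x) = f u x (f x x (skew G f x))"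
    using assoc1[of u x x x "skew G f x"] assoc2[of u x x x "skew G f x"] u s x by simp
  then show ?thesis using u s by simp
qed

lemma skew_left_neutral:
  assumes x: "x \<in> G" and y: "y \<in> G"
  shows "f (skew G f x) x y = y"
proof -
  note s = skew_props[OF x]
  have "f x x (f (skew G f x) x y) = f (f x x (skew G f x)) x y"
    using assoc1[of x x "skew G f x" x y] assoc2[of x x "skew G f x" x y] s x y by simp
  then have "f x x (f (skew G f x) x y) = f x x y" using s by simp
  moreover have "f (skew G f x) x y \<in> G" "f x x y \<in> G" using closed s x y by auto
  ultimately show ?thesis using solve3[OF x x, of "f x x y"] y by blast
qed

lemma group_retract:
  assumes e: "e \<in> G"
  shows "Group.group (retract G f e)"
proof (rule groupI)
  fix x y assume "x \<in> carrier (retract G f e)" "y \<in> carrier (retract G f e)"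
  then show "x \<otimes>\<^bsub>retract G f e\<^esub> y \<in> carrier (retract G f e)"
    using closed e by (simp add: retract_def)
next
  show "\<one>\<^bsub>retract G f e\<^esub> \<in> carrier (retract G f e)"
    using skew_props(1)[OF e] by (simp add: retract_def)
next
  fix x y z
  assume "x \<in> carrier (retract G f e)" "y \<in> carrier (retract G f e)" "z \<in> carrier (retract G f e)"
  then show "x \<otimes>\<^bsub>retract G f e\<^esub> y \<otimes>\<^bsub>retract G f e\<^esub> z =
      x \<otimes>\<^bsub>retract G f e\<^esub> (y \<otimes>\<^bsub>retract G f e\<^esub> z)"
    using assoc1[of x e y e z] assoc2[of x e y e z] e by (simp add: retract_def)
next
  fix x assume "x \<in> carrier (retract G f e)"
  then show "\<one>\<^bsub>retract G f e\<^esub> \<otimes>\<^bsub>retract G f e\<^esub> x = x"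
    using skew_left_neutral[OF e] by (simp add: retract_def)
next
  fix x assume "x \<in> carrier (retract G f e)"
  then show "\<exists>y\<in>carrier (retract G f e). y \<otimes>\<^bsub>retract G f e\<^esub> x = \<one>\<^bsub>retract G f e\<^esub>"
    using solve1[OF e _ skew_props(1)[OF e], of x] by (auto simp: retract_def)
qed

end

lemma group_GL:
  assumes "vector_space scale"
  shows "Group.group (GL scale)"
proof (rule groupI)
  fix S T assume "S \<in> carrier (GL scale)" "T \<in> carrier (GL scale)"
  then show "S \<otimes>\<^bsub>GL scale\<^esub> T \<in> carrier (GL scale)"
    by (auto simp: GL_def intro: bij_comp Vector_Spaces.linear_compose)
next
  show "\<one>\<^bsub>GL scale\<^esub> \<in> carrier (GL scale)"
    using vector_space.linear_id[OF assms] by (simp add: GL_def)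
next
  fix T assume T: "T \<in> carrier (GL scale)"
  then interpret Vector_Spaces.linear scale scale T by (simp add: GL_def)
  have "bij T" using T by (simp add: GL_def)
  then have surj: "T (inv_into UNIV T x) = x" and inj: "inj T" for x
    by (simp_all add: bij_is_surj surj_f_inv_f bij_is_inj)
  have "Vector_Spaces.linear scale scale (inv_into UNIV T)"
  proof unfold_locales
    fix x y
    show "inv_into UNIV T (x + y) = inv_into UNIV T x + inv_into UNIV T y"
      by (rule injD[OF inj]) (simp only: add surj)
  next
    fix c x
    show "inv_into UNIV T (scale c x) = scale c (inv_into UNIV T x)"
      by (rule injD[OF inj]) (simp only: scale surj)
  qed
  with \<open>bij T\<close> have "inv_into UNIV T \<in> carrier (GL scale)"
    by (simp add: GL_def bij_imp_bij_inv)
  moreover have "inv_into UNIV T \<circ> T = id" using inj by simp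
  ultimately show "\<exists>S\<in>carrier (GL scale). S \<otimes>\<^bsub>GL scale\<^esub> T = \<one>\<^bsub>GL scale\<^esub>"
    by (auto simp: GL_def)
qed (auto simp: GL_def comp_assoc)

end

theory Submission
  imports Defs
begin

text \<open>
  Write \<open>s\<close> for the skew element of \<open>e\<close>, which is the identity of the retract, and \<open>\<cdot>\<close> for
  the product of the retract.  The ternary operation is recovered from the retract by
  \<open>f x y z = x \<cdot> \<phi> y \<cdot> z\<close> with \<open>\<phi> y = f s y s\<close>, so a homomorphism of the retract respects
  \<open>f\<close> precisely when it does not see the difference between \<open>\<phi> y\<close> and \<open>y\<close>.
  Inserting \<open>x = z = skew y\<close> makes the left-hand side collapse to \<open>skew y\<close>, and
  cancellation shows that \<open>\<phi> y\<close> is the inverse of \<open>skew y\<close> in the retract.  Hence the condition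
  becomes that the images of \<open>skew y\<close> and \<open>y\<close> are mutually inverse.  The non-empty kernel comes
  for free: a homomorphism sends \<open>s\<close>, the identity of the retract, to the identity map.
\<close>

context ternary_group
begin

text \<open>
  This is the ternary case of the Hosszu-Gluskin decomposition: the neutral pairs
  \<open>(e, s)\<close> on the right of \<open>x\<close> and \<open>(s, e)\<close> on the left of \<open>z\<close> are inserted and the
  brackets are moved.
\<close>

lemma ternary_operation_by_retract:
  assumes e: "e \<in> G" and x: "x \<in> G" and y: "y \<in> G" and z: "z \<in> G"
  defines "s \<equiv> skew G f e"
  shows "f x y z = f (f x e (f s y s)) e z"
proof -
  have s: "s \<in> G" using skew_props(1)[OF e] by (simp add: s_def)
  have "f x y z = f (f x e s) y z"
    using skew_right_neutral[OF e x] by (simp add: s_def)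
  also have "\<dots> = f (f x e s) y (f s e z)"
    using skew_left_neutral[OF e z] by (simp add: s_def)
  also have "\<dots> = f (f (f x e s) y s) e z"
    using assoc1[of "f x e s" y s e z] assoc2[of "f x e s" y s e z] closed[OF x e s] e s y z
    by simp
  also have "f (f x e s) y s = f x e (f s y s)"
    using assoc1[of x e s y s] assoc2[of x e s y s] e s x y by simp
  finally show ?thesis .
qed

text \<open>
  With \<open>t = skew y\<close>, the pair \<open>(t, y)\<close> is neutral, so \<open>f t y t = t\<close>; the decomposition turns
  this into \<open>t \<cdot> f s y s \<cdot> t = t\<close> in the retract.
\<close>

lemma retract_inverse_of_skew:
  assumes e: "e \<in> G" and y: "y \<in> G"
  defines "s \<equiv> skew G f e"
  shows "f s y s = inv\<^bsub>retract G f e\<^esub> (skew G f y)"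
proof -
  let ?R = "retract G f e" and ?t = "skew G f y"
  interpret R: group ?R by (rule group_retract[OF e])
  have s: "s \<in> G" using skew_props(1)[OF e] by (simp add: s_def)
  have t: "?t \<in> G" by (rule skew_props(1)[OF y])
  have car: "f s y s \<in> carrier ?R" "?t \<in> carrier ?R"
    using closed s y t by (auto simp: retract_def)
  have "f (f ?t e (f s y s)) e ?t = ?t"
    using ternary_operation_by_retract[OF e t y t] skew_left_neutral[OF y t] by (simp add: s_def)
  then have "?t \<otimes>\<^bsub>?R\<^esub> f s y s \<otimes>\<^bsub>?R\<^esub> ?t = ?t"
    by (simp add: retract_def)
  then have "?t \<otimes>\<^bsub>?R\<^esub> f s y s = \<one>\<^bsub>?R\<^esub>"
    using car by (simp only: R.r_cancel_one R.m_closed)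
  then have "f s y s \<otimes>\<^bsub>?R\<^esub> ?t = \<one>\<^bsub>?R\<^esub>"
    using car by (simp only: R.inv_comm)
  then show ?thesis using car by (simp only: R.inv_equality)
qed

text \<open>
  In one direction, cancel in the defining equation \<open>f x x (skew x) = x\<close>.  In the other, the
  hypothesis says that \<open>h\<close> sends the inverse of \<open>skew y\<close> in the retract to \<open>h y\<close>, and this inverse
  is the middle factor in the decomposition of \<open>f x y z\<close>.
\<close>

lemma retract_hom_ternary_iff_skew_inverse:
  assumes e: "e \<in> G" and H: "Group.group H" and hom: "h \<in> hom (retract G f e) H"
  shows "(\<forall>x\<in>G. \<forall>y\<in>G. \<forall>z\<in>G. h (f x y z) = h x \<otimes>\<^bsub>H\<^esub> h y \<otimes>\<^bsub>H\<^esub> h z) \<longleftrightarrow>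
    (\<forall>x\<in>G. h (skew G f x) = inv\<^bsub>H\<^esub> (h x))"
    (is "?ternary \<longleftrightarrow> ?inverse")
proof -
  interpret H: group H by (rule H)
  interpret h: group_hom "retract G f e" H h
    by (intro group_hom.intro group_hom_axioms.intro group_retract e H hom)
  have car: "h x \<in> carrier H" if "x \<in> G" for x
    using h.hom_closed[of x] that by (simp add: retract_def)
  have mult: "h (f x e y) = h x \<otimes>\<^bsub>H\<^esub> h y" if "x \<in> G" "y \<in> G" for x y
    using h.hom_mult[of x y] that by (simp add: retract_def)
  show ?thesis
  proof
    assume hom3: ?ternary
    show ?inverse
    proof
      fix x assume x: "x \<in> G"
      let ?t = "skew G f x"
      note t = skew_props[OF x]
      have "h x \<otimes>\<^bsub>H\<^esub> (h x \<otimes>\<^bsub>H\<^esub> h ?t) = h x"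
        using bspec[OF bspec[OF bspec[OF hom3 x] x] t(1)] t x car[OF x] car[OF t(1)]
        by (simp add: H.m_assoc)
      then have "h x \<otimes>\<^bsub>H\<^esub> h ?t = \<one>\<^bsub>H\<^esub>"
        using car[OF x] car[OF t(1)] by (metis H.l_cancel_one H.m_closed)
      then have "h ?t \<otimes>\<^bsub>H\<^esub> h x = \<one>\<^bsub>H\<^esub>"
        using car[OF x] car[OF t(1)] by (simp only: H.inv_comm)
      then show "h ?t = inv\<^bsub>H\<^esub> (h x)"
        using car[OF x] car[OF t(1)] by (simp only: H.inv_equality)
    qed
  next
    assume skew_inv: ?inverse
    let ?s = "skew G f e"
    have s: "?s \<in> G" by (rule skew_props(1)[OF e])
    have twist: "h (f ?s y ?s) = h y" if y: "y \<in> G" for y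
    proof -
      have "skew G f y \<in> carrier (retract G f e)"
        using skew_props(1)[OF y] by (simp add: retract_def)
      then have "h (f ?s y ?s) = inv\<^bsub>H\<^esub> (h (skew G f y))"
        by (simp add: retract_inverse_of_skew[OF e y])
      then show ?thesis using skew_inv y car by simp
    qed
    show ?ternary
    proof (intro ballI)
      fix x y z assume xyz: "x \<in> G" "y \<in> G" "z \<in> G"
      have "h (f x y z) = h (f (f x e (f ?s y ?s)) e z)"
        using ternary_operation_by_retract[OF e xyz] by (rule arg_cong)
      then show "h (f x y z) = h x \<otimes>\<^bsub>H\<^esub> h y \<otimes>\<^bsub>H\<^esub> h z"
        using xyz e s closed by (simp add: mult twist)
    qed
  qed
qed

end

theorem corollary3p16:
  fixes G :: "'a set" and f :: "'a \<Rightarrow> 'a \<Rightarrow> 'a \<Rightarrow> 'a" and e :: 'a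
    and scale :: "complex \<Rightarrow> 'v \<Rightarrow> 'v::ab_group_add" and Basis :: "'v set"
    and \<Gamma> :: "'a \<Rightarrow> 'v \<Rightarrow> 'v"
  assumes "ternary_group G f"
    and "e \<in> G"
    and "finite_dimensional_vector_space scale Basis"
    and "group_rep (retract G f e) scale \<Gamma>"
  shows "ternary_rep G f scale \<Gamma> \<longleftrightarrow>
    (\<forall>x\<in>G. \<Gamma> (skew G f x) = inv\<^bsub>GL scale\<^esub> (\<Gamma> x))"
proof -
  interpret ternary_group G f by (rule assms(1))
  have GL: "Group.group (GL scale)"
    using assms(3) by (intro group_GL) (simp add: finite_dimensional_vector_space_def)
  have hom: "\<Gamma> \<in> hom (retract G f e) (GL scale)"
    using assms(4) by (simp add: group_rep_def)
  have "\<Gamma> \<in> G \<rightarrow> carrier (GL scale)"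
    using hom by (auto simp: hom_def retract_def)
  moreover have "skew G f e \<in> ternary_ker G scale \<Gamma>"
    using hom_one[OF hom group_retract[OF assms(2)] GL] skew_props(1)[OF assms(2)]
    by (simp add: ternary_ker_def retract_def)
  ultimately show ?thesis
    using retract_hom_ternary_iff_skew_inverse[OF assms(2) GL hom]
    by (auto simp: ternary_rep_def)
qed

end
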